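(* Let $n\in\mathbb{N}\cup\{0\}$ and let $f:\mathbb{N}\to\mathbb{N}$ be a polynomial function of the form $f(x)=\sum_{k=0}^{n}a_kx^k$ with $a_0,a_1,\dots,a_n\in\mathbb{N}\cup\{0\}$. Then $f$ is continuous as a map $M(\mathbb{N})\to M(\mathbb{N})$ if and only if for every prime number $p$ one has $f^{-1}(\sigma_p)=\sigma_p$, or $f^{-1}(\sigma_p)=\mathbb{N}$, or $f^{-1}(\sigma_p)=\emptyset$.
   Context: $\mathbb{N}$ denotes the set of positive integers. For $n\in\mathbb{N}$ put $\sigma_n:=\{m\in\mathbb{N}:\gcd(n,m)=1\}$. The Macías space $M(\mathbb{N})$ is the topological space $(\mathbb{N},\tau_M)$, where $\tau_M$ is the topology generated by the collection $\{\sigma_n:n\in\mathbb{N}\}$ (this collection is a base of $\tau_M$, since $\sigma_{nm}=\sigma_n\cap\sigma_m$ and $\sigma_1=\mathbb{N}$). *)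

theory Defs
  imports "HOL-Analysis.Abstract_Topology" "HOL-Analysis.Function_Topology"
    "HOL-Computational_Algebra.Primes"
begin

text \<open>The positive integers are the subset \<open>{0<..}\<close> of the type \<^typ>\<open>nat\<close>.\<close>

definition macias_sigma :: "nat \<Rightarrow> nat set" where
  "macias_sigma n = {m. 0 < m \<and> gcd n m = 1}"

text \<open>The index 0 has to be excluded: \<open>macias_sigma 0 = {1}\<close> is not open.\<close>

definition macias_topology :: "nat topology" where
  "macias_topology = topology_generated_by (macias_sigma ` {0<..})"

lemma topspace_macias_topology: "topspace macias_topology = {0<..}"
proof -
  have "\<Union> (macias_sigma ` {0<..}) = {0<..}"
    by (force simp: macias_sigma_def)
  then show ?thesis
    by (simp only: macias_topology_def topology_generated_by_topspace)
qed

end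

theory Submission
  imports Defs "HOL-Number_Theory.Cong"
begin

text \<open>
  For a prime \<open>p\<close>, whether \<open>p\<close> divides \<open>f x\<close> depends only on \<open>x mod p\<close>, so the positive preimage of
  \<open>macias_sigma p\<close> is a union of residue classes modulo \<open>p\<close>.  The proof compares this with the shape of
  the open sets.  By the Chinese remainder theorem, the numbers coprime to a given \<open>m > 0\<close> represent
  every residue class modulo \<open>p\<close> except possibly that of \<open>0\<close>.  Hence a nonempty open set that is a
  union of residue classes modulo \<open>p\<close> contains all of \<open>macias_sigma p\<close>, and the only remaining
  freedom is whether it contains the class of \<open>0\<close>: it is \<open>macias_sigma p\<close> or everything
  (\<open>openin_macias_periodic_cases\<close>).  This is why continuity forces the trichotomy.

  Conversely, \<open>macias_sigma\<close> turns products into intersections, so a map into the Macias space is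
  continuous as soon as the preimages of the sets \<open>macias_sigma p\<close> with \<open>p\<close> prime are open
  (\<open>continuous_map_macias_iff_prime\<close>), and all three sets allowed by the trichotomy are open.
\<close>

lemma macias_sigma_coprime: "macias_sigma n = {m. 0 < m \<and> coprime n m}"
  unfolding macias_sigma_def coprime_iff_gcd_eq_1 by (rule refl)

lemma macias_sigma_1: "macias_sigma (Suc 0) = {0<..}"
  by (auto simp: macias_sigma_def)

lemma macias_sigma_mult: "macias_sigma (k * m) = macias_sigma k \<inter> macias_sigma m"
  by (auto simp: macias_sigma_coprime)

lemma macias_sigma_prime:
  assumes "prime p"
  shows "macias_sigma p = {x. 0 < x \<and> \<not> p dvd x}"
  using assms
  by (auto simp: macias_sigma_coprime intro: prime_imp_coprime dest: coprime_common_divisor[of _ _ p])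

lemma openin_macias_sigma: "0 < m \<Longrightarrow> openin macias_topology (macias_sigma m)"
  unfolding macias_topology_def by (rule topology_generated_by_Basis) auto

text \<open>The sets \<open>macias_sigma m\<close> are a base and not only a subbase, because a finite intersection
  of them is again one of them.\<close>

lemma openin_macias_contains_sigma:
  assumes "openin macias_topology U" "x \<in> U"
  shows "\<exists>m>0. x \<in> macias_sigma m \<and> macias_sigma m \<subseteq> U"
proof -
  have "generate_topology_on (macias_sigma ` {0<..}) U"
    using assms(1) by (simp add: macias_topology_def openin_topology_generated_by_iff)
  then show ?thesis
    using assms(2)
  proof (induction arbitrary: x)
    case (Int U V)
    then obtain k m where "0 < k" "x \<in> macias_sigma k" "macias_sigma k \<subseteq> U"
      and "0 < m" "x \<in> macias_sigma m" "macias_sigma m \<subseteq> V"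
      by (meson IntD1 IntD2)
    then show ?case
      by (intro exI[of _ "k * m"]) (auto simp: macias_sigma_mult)
  next
    case (UN K)
    then show ?case by (meson Union_iff Union_upper subset_trans)
  qed auto
qed

lemma exists_cong_coprime:
  fixes p m y :: nat
  assumes "prime p" "0 < m" "\<not> p dvd y"
  shows "\<exists>z. [z = y] (mod p) \<and> coprime z m"
proof -
  \<comment> \<open>The part of \<open>m\<close> prime to \<open>p\<close> is split off, since only for it can the residue of \<open>z\<close> be
      prescribed independently of \<open>z mod p\<close>.\<close>
  obtain q where q: "m = p ^ multiplicity p m * q" "\<not> p dvd q"
  proof (rule multiplicity_decompose'[of m p])
    show "m \<noteq> 0" "\<not> is_unit p"
      using assms(1,2) by (auto dest: not_prime_unit)
  qed
  then have "coprime p q"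
    using assms(1) prime_imp_coprime by blast
  then obtain z where z: "[z = y] (mod p)" "[z = 1] (mod q)"
    using binary_chinese_remainder_nat by blast
  have "coprime z p"
    using z(1) assms(1,3) by (metis cong_dvd_iff coprime_commute prime_imp_coprime)
  moreover have "coprime z q"
    using z(2) by (metis cong_imp_coprime cong_sym coprime_1_left)
  ultimately have "coprime z m"
    by (subst q(1)) simp
  with z(1) show ?thesis by blast
qed

text \<open>An open set around a point contains some \<open>macias_sigma m\<close>, hence representatives of all
  nonzero residue classes modulo \<open>p\<close>; periodicity then spreads each of them over its class.\<close>

lemma openin_macias_periodic_cases:
  assumes p: "prime p" and U: "openin macias_topology U"
    and per: "\<And>x y. x \<in> U \<Longrightarrow> 0 < y \<Longrightarrow> [x = y] (mod p) \<Longrightarrow> y \<in> U"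
  shows "U = macias_sigma p \<or> U = {0<..} \<or> U = {}"
proof (cases "U = {}")
  case False
  have pos: "U \<subseteq> {0<..}"
    using openin_subset[OF U] by (simp add: topspace_macias_topology)
  obtain m where m: "0 < m" "macias_sigma m \<subseteq> U"
    using False openin_macias_contains_sigma[OF U] by blast
  have sub: "y \<in> U" if y: "0 < y" "\<not> p dvd y" for y
  proof -
    obtain z where z: "[z = y] (mod p)" "coprime z m"
      using exists_cong_coprime[OF p m(1) y(2)] by blast
    have "0 < z"
      using z(1) y(2) by (metis cong_dvd_iff dvd_0_right neq0_conv)
    then have "z \<in> macias_sigma m"
      using z(2) by (simp add: macias_sigma_coprime coprime_commute)
    then show ?thesis
      using m(2) per y(1) z(1) by blast
  qed
  show ?thesis
  proof (cases "\<exists>y\<in>U. p dvd y")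
    case True
    then obtain y where "y \<in> U" "p dvd y" by blast
    then have "w \<in> U" if "0 < w" for w
      using that sub per[of y w] by (cases "p dvd w") (auto simp: cong_def)
    then show ?thesis using pos by auto
  next
    case False
    then show ?thesis
      using sub pos by (auto simp: macias_sigma_prime[OF p])
  qed
qed simp

lemma continuous_map_macias_iff_prime:
  assumes "f \<in> topspace X \<rightarrow> {0<..}"
  shows "continuous_map X macias_topology f \<longleftrightarrow>
    (\<forall>p. prime p \<longrightarrow> openin X (f -` macias_sigma p \<inter> topspace X))"
proof
  assume "continuous_map X macias_topology f"
  then show "\<forall>p. prime p \<longrightarrow> openin X (f -` macias_sigma p \<inter> topspace X)"
    by (auto simp: macias_topology_def continuous_on_generated_topo_iff prime_gt_0_nat)
next
  assume primes: "\<forall>p. prime p \<longrightarrow> openin X (f -` macias_sigma p \<inter> topspace X)"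
  have "openin X (f -` macias_sigma m \<inter> topspace X)" if "0 < m" for m
    using that
  proof (induction m rule: prime_divisors_induct)
    case (unit m)
    have "f -` macias_sigma m \<inter> topspace X = topspace X"
      using assms unit by (auto simp: macias_sigma_1)
    then show ?case by simp
  next
    case (factor p m)
    have "f -` macias_sigma (p * m) \<inter> topspace X =
        (f -` macias_sigma p \<inter> topspace X) \<inter> (f -` macias_sigma m \<inter> topspace X)"
      by (auto simp: macias_sigma_mult)
    then show ?case
      using factor primes by auto
  qed simp
  moreover have "f ` topspace X \<subseteq> \<Union> (macias_sigma ` {0<..})"
    using assms macias_sigma_1 by blast
  ultimately show "continuous_map X macias_topology f"
    by (auto simp: macias_topology_def continuous_on_generated_topo_iff)
qed

theorem theorem3p3:
  fixes n :: nat and a :: "nat \<Rightarrow> nat" and f :: "nat \<Rightarrow> nat"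
  assumes "f \<in> {0<..} \<rightarrow> {0<..}"
    and "\<And>x. 0 < x \<Longrightarrow> f x = (\<Sum>k=0..n. a k * x ^ k)"
  shows "continuous_map macias_topology macias_topology f \<longleftrightarrow>
    (\<forall>p. prime p \<longrightarrow>
      f -` macias_sigma p \<inter> {0<..} = macias_sigma p \<or>
      f -` macias_sigma p \<inter> {0<..} = {0<..} \<or>
      f -` macias_sigma p \<inter> {0<..} = {})"
proof -
  have cont_iff: "continuous_map macias_topology macias_topology f \<longleftrightarrow>
      (\<forall>p. prime p \<longrightarrow> openin macias_topology (f -` macias_sigma p \<inter> {0<..}))"
    using continuous_map_macias_iff_prime[of f macias_topology] assms(1)
    by (simp add: topspace_macias_topology)
  have open_iff: "openin macias_topology (f -` macias_sigma p \<inter> {0<..}) \<longleftrightarrow>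
      f -` macias_sigma p \<inter> {0<..} = macias_sigma p \<or>
      f -` macias_sigma p \<inter> {0<..} = {0<..} \<or>
      f -` macias_sigma p \<inter> {0<..} = {}" (is "openin _ ?U \<longleftrightarrow> ?cases") if p: "prime p" for p
  proof
    have per: "y \<in> ?U" if "x \<in> ?U" "0 < y" "[x = y] (mod p)" for x y
    proof -
      have "[f x = f y] (mod p)"
        using that assms(2) by (auto intro!: cong_sum cong_mult cong_pow)
      then have "p dvd f x \<longleftrightarrow> p dvd f y"
        by (rule cong_dvd_iff)
      moreover have "0 < f y"
        using assms(1) \<open>0 < y\<close> by auto
      ultimately show ?thesis
        using that by (auto simp: macias_sigma_prime[OF p])
    qed
    show ?cases if "openin macias_topology ?U"
      using that by (rule openin_macias_periodic_cases[OF p]) (rule per)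
    show "openin macias_topology ?U" if ?cases
      using that p openin_macias_sigma[of p] openin_macias_sigma[of "Suc 0"]
      by (auto simp: macias_sigma_1 prime_gt_0_nat)
  qed
  show ?thesis
    by (simp only: cont_iff open_iff cong: imp_cong)
qed

end
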